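(* Let $\beta\in c_{\rm inc}$ with $\beta(-1)=0$, and let $c\in\mathbb{C}$. Let $D_{\beta,\tau_0}$ and $\tilde D_{\beta,\tau_0}$ be the closures in $\ell^2(\mathbb{N})$ of the operators defined on the linear span of the canonical basis $\{E_k\}$ by $$D_{\beta,\tau_0}=c\cdot I+\beta(\mathbb{K}-1),\qquad \tilde D_{\beta,\tau_0}=U\beta(\mathbb{K}).$$ Then the operators $D_{\beta,\tau_0}$, $\tilde D_{\beta,\tau_0}$ have compact parametrices if and only if $\beta(k)\to\infty$ as $k\to\infty$.
   Context: $\mathbb{N}$ is the set of nonnegative integers, $\{E_k\}$ the canonical basis of $\ell^2(\mathbb{N})$, $U$ the unilateral shift $UE_k=E_{k+1}$; $\beta(\mathbb{K})E_k=\beta(k)E_k$ and $\beta(\mathbb{K}-1)E_k=\beta(k-1)E_k$ with the convention $\beta(-1):=0$. $c_{\rm inc}$ is the set of $\beta:\mathbb{N}\to\mathbb{C}$ such that $\{\beta(k)-\beta(k-1)\}_{k\ge0}$ converges. $D_{\beta,\tau_0}$ and $\tilde D_{\beta,\tau_0}$ are the implementations, in the GNS space $\ell^2(\mathbb{N})$ of the state $\tau_0(a)=\langle E_0,aE_0\rangle$ on the Toeplitz algebra, of the derivations $a\mapsto[\beta(\mathbb{K}-1),a]$ and $a\mapsto[U\beta(\mathbb{K}),a]$ respectively. A closed densely defined operator $D$ on a Hilbert space has compact parametrices if $(I+D^*D)^{-1/2}$ and $(I+DD^* )^{-1/2}$ are compact. For complex sequences, $\beta(k)\to\infty$ means $|\beta(k)|\to\infty$.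 The equivalence is asserted for each of the two operators. *)

theory Defs
  imports "HOL-Analysis.Analysis"
begin

section \<open>The complex Hilbert space of square-summable sequences\<close>

typedef ell2 = "{x :: nat \<Rightarrow> complex. summable (\<lambda>k. (cmod (x k))\<^sup>2)}"
  morphisms coord Abs_ell2
  by (rule exI[of _ "\<lambda>_. 0"]) simp

setup_lifting type_definition_ell2

lemma ell2_eqI: "(\<And>k. coord x k = coord y k) \<Longrightarrow> x = y"
  by (metis coord_inject ext)

lemma summable_coord: "summable (\<lambda>k. (cmod (coord x k))\<^sup>2)"
  using coord[of x] by simp

lemma cmod_mult_le_squares: "cmod (cnj a * b) \<le> (cmod a)\<^sup>2 + (cmod b)\<^sup>2"
proof -
  have "2 * (cmod a * cmod b) \<le> (cmod a)\<^sup>2 + (cmod b)\<^sup>2"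
    using sum_squares_bound[of "cmod a" "cmod b"] by (simp add: mult.assoc)
  moreover have "0 \<le> cmod a * cmod b" by simp
  ultimately have "cmod a * cmod b \<le> (cmod a)\<^sup>2 + (cmod b)\<^sup>2" by linarith
  then show ?thesis by (simp add: norm_mult)
qed

lemma summable_cnj_mult:
  assumes "summable (\<lambda>k. (cmod (f k))\<^sup>2)" "summable (\<lambda>k. (cmod (g k))\<^sup>2)"
  shows "summable (\<lambda>k. cnj (f k) * g k)"
  by (rule summable_comparison_test'[OF summable_add[OF assms]])
     (rule cmod_mult_le_squares)

lemma summable_square_add:
  fixes f g :: "nat \<Rightarrow> complex"
  assumes "summable (\<lambda>k. (cmod (f k))\<^sup>2)" "summable (\<lambda>k. (cmod (g k))\<^sup>2)"
  shows "summable (\<lambda>k. (cmod (f k + g k))\<^sup>2)"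
proof (rule summable_comparison_test')
  show "summable (\<lambda>k. 2 * ((cmod (f k))\<^sup>2 + (cmod (g k))\<^sup>2))"
    by (intro summable_mult summable_add assms)
next
  fix k
  have "(cmod (f k + g k))\<^sup>2 \<le> (cmod (f k) + cmod (g k))\<^sup>2"
    by (intro power_mono norm_triangle_ineq) simp
  also have "\<dots> \<le> 2 * ((cmod (f k))\<^sup>2 + (cmod (g k))\<^sup>2)"
    using sum_squares_bound[of "cmod (f k)" "cmod (g k)"] by (simp add: power2_sum)
  finally show "norm ((cmod (f k + g k))\<^sup>2) \<le> 2 * ((cmod (f k))\<^sup>2 + (cmod (g k))\<^sup>2)"
    by simp
qed

lift_definition scaleC :: "complex \<Rightarrow> ell2 \<Rightarrow> ell2" is "\<lambda>c x k. c * x k"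
  by (simp add: norm_mult power_mult_distrib summable_mult)

definition cinner :: "ell2 \<Rightarrow> ell2 \<Rightarrow> complex" where
  "cinner x y = (\<Sum>k. cnj (coord x k) * coord y k)"

lemma cinner_self: "cinner x x = of_real (\<Sum>k. (cmod (coord x k))\<^sup>2)"
proof -
  have "cinner x x = (\<Sum>k. of_real ((cmod (coord x k))\<^sup>2))"
    unfolding cinner_def complex_norm_square by (simp add: mult.commute)
  then show ?thesis
    using suminf_of_real[OF summable_coord[of x]] by metis
qed

instantiation ell2 :: real_inner
begin

lift_definition zero_ell2 :: ell2 is "\<lambda>k. 0" by simp
lift_definition plus_ell2 :: "ell2 \<Rightarrow> ell2 \<Rightarrow> ell2" is "\<lambda>x y k. x k + y k"
  by (simp add: summable_square_add)
lift_definition uminus_ell2 :: "ell2 \<Rightarrow> ell2" is "\<lambda>x k. - x k" by simp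
lift_definition minus_ell2 :: "ell2 \<Rightarrow> ell2 \<Rightarrow> ell2" is "\<lambda>x y k. x k - y k"
  using summable_square_add[where g = "\<lambda>k. - _ k"] by simp
lift_definition scaleR_ell2 :: "real \<Rightarrow> ell2 \<Rightarrow> ell2" is "\<lambda>r x k. complex_of_real r * x k"
  by (simp add: norm_mult power_mult_distrib summable_mult)

definition inner_ell2 :: "ell2 \<Rightarrow> ell2 \<Rightarrow> real" where
  "inner_ell2 x y = Re (cinner x y)"
definition norm_ell2 :: "ell2 \<Rightarrow> real" where
  "norm_ell2 x = sqrt (\<Sum>k. (cmod (coord x k))\<^sup>2)"
definition dist_ell2 :: "ell2 \<Rightarrow> ell2 \<Rightarrow> real" where
  "dist_ell2 x y = norm (x - y)"
definition sgn_ell2 :: "ell2 \<Rightarrow> ell2" where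
  "sgn_ell2 x = inverse (norm x) *\<^sub>R x"
definition uniformity_ell2 :: "(ell2 \<times> ell2) filter" where
  "uniformity_ell2 = (INF e\<in>{0<..}. principal {(x, y). dist x y < e})"
definition open_ell2 :: "ell2 set \<Rightarrow> bool" where
  "open_ell2 S \<longleftrightarrow> (\<forall>x\<in>S. \<forall>\<^sub>F (x', y) in uniformity. x' = x \<longrightarrow> y \<in> S)"

instance
proof
  fix x y z :: ell2 and r s :: real
  show "x + y + z = x + (y + z)" "x + y = y + x" "0 + x = x" "- x + x = 0" "x - y = x + - y"
    by (transfer; simp add: fun_eq_iff algebra_simps)+
  show "r *\<^sub>R (x + y) = r *\<^sub>R x + r *\<^sub>R y" "(r + s) *\<^sub>R x = r *\<^sub>R x + s *\<^sub>R x"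
    "r *\<^sub>R s *\<^sub>R x = (r * s) *\<^sub>R x" "1 *\<^sub>R x = x"
    by (transfer; simp add: fun_eq_iff algebra_simps)+
  show "dist x y = norm (x - y)" by (rule dist_ell2_def)
  show "sgn x = inverse (norm x) *\<^sub>R x" by (rule sgn_ell2_def)
  show "uniformity = (INF e\<in>{0<..}. principal {(x, y :: ell2). dist x y < e})"
    by (rule uniformity_ell2_def)
  show "open S \<longleftrightarrow> (\<forall>x\<in>S. \<forall>\<^sub>F (x', y) in uniformity. x' = x \<longrightarrow> y \<in> S)" for S :: "ell2 set"
    by (rule open_ell2_def)
  have sm: "summable (\<lambda>k. cnj (coord u k) * coord v k)" for u v
    by (intro summable_cnj_mult summable_coord)
  have sRe: "summable (\<lambda>k. Re (cnj (coord u k) * coord v k))" for u v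
    using sm[of u v] by (rule summable_Re)
  have inner_eq: "inner u v = (\<Sum>k. Re (cnj (coord u k) * coord v k))" for u v
    unfolding inner_ell2_def cinner_def by (rule Re_suminf[OF sm])
  show "inner x y = inner y x"
    unfolding inner_eq by (simp add: algebra_simps)
  show "inner (x + y) z = inner x z + inner y z"
    unfolding inner_eq suminf_add[OF sRe sRe]
    by (simp add: plus_ell2.rep_eq algebra_simps)
  show "inner (r *\<^sub>R x) y = r * inner x y"
    unfolding inner_eq suminf_mult[OF sRe, symmetric]
    by (simp add: scaleR_ell2.rep_eq algebra_simps)
  have self: "inner u u = (\<Sum>k. (cmod (coord u k))\<^sup>2)" for u
    unfolding inner_ell2_def cinner_self by simp
  show "0 \<le> inner x x"
    unfolding self by (intro suminf_nonneg summable_coord) simp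
  show "inner x x = 0 \<longleftrightarrow> x = 0"
  proof
    assume "inner x x = 0"
    then have "\<forall>k. (cmod (coord x k))\<^sup>2 = 0"
      unfolding self using suminf_eq_zero_iff[OF summable_coord[of x]] by simp
    then show "x = 0" by (intro ell2_eqI) (simp add: zero_ell2.rep_eq)
  next
    assume "x = 0"
    then show "inner x x = 0" unfolding self by (simp add: zero_ell2.rep_eq)
  qed
  show "norm x = sqrt (inner x x)" unfolding self norm_ell2_def ..
qed

end

global_interpretation ell2: vector_space scaleC
  by unfold_locales (transfer; simp add: fun_eq_iff algebra_simps)+

lift_definition basis :: "nat \<Rightarrow> ell2" is "\<lambda>n k. if k = n then 1 else 0"
  by (rule summable_finite[of "{_}"]) auto


section \<open>Unbounded operators\<close>

text \<open>
  An operator is identified with its graph: \<open>(x, y) \<in> D\<close> means that \<open>x\<close> is in the domain of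
  \<open>D\<close> and \<open>D x = y\<close>. The composite \<open>A \<circ> B\<close> is \<open>B O A\<close>, the inverse is the converse relation, the
  domain is \<^const>\<open>Domain\<close>, and the closure of an operator is the topological \<^const>\<open>closure\<close> of
  its graph.
\<close>

type_synonym operator = "(ell2 \<times> ell2) set"

definition graph :: "(ell2 \<Rightarrow> ell2) \<Rightarrow> operator" where
  "graph T = {(x, T x) |x. True}"

definition op_plus :: "operator \<Rightarrow> operator \<Rightarrow> operator" where
  "op_plus A B = {(x, y + z) |x y z. (x, y) \<in> A \<and> (x, z) \<in> B}"

definition restrict_op :: "operator \<Rightarrow> ell2 set \<Rightarrow> operator" where
  "restrict_op A S = {(x, y) \<in> A. x \<in> S}"

definition linear_operator :: "operator \<Rightarrow> bool" where
  "linear_operator D \<longleftrightarrow> (0, 0) \<in> D \<and> single_valued D \<and>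
     (\<forall>(x, y)\<in>D. \<forall>(x', y')\<in>D. (x + x', y + y') \<in> D) \<and>
     (\<forall>a. \<forall>(x, y)\<in>D. (scaleC a x, scaleC a y) \<in> D)"

definition closed_densely_defined :: "operator \<Rightarrow> bool" where
  "closed_densely_defined D \<longleftrightarrow> linear_operator D \<and> closed D \<and> closure (Domain D) = UNIV"

definition adjoint_op :: "operator \<Rightarrow> operator" where
  "adjoint_op D = {(y, z). \<forall>(x, w)\<in>D. cinner y w = cinner z x}"

definition bounded_clinear :: "(ell2 \<Rightarrow> ell2) \<Rightarrow> bool" where
  "bounded_clinear T \<longleftrightarrow> bounded_linear T \<and> (\<forall>a x. T (scaleC a x) = scaleC a (T x))"

definition positive_operator :: "(ell2 \<Rightarrow> ell2) \<Rightarrow> bool" where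
  "positive_operator T \<longleftrightarrow> bounded_clinear T \<and> (\<forall>x. cinner x (T x) \<in> \<real>\<^sub>\<ge>\<^sub>0)"

definition compact_operator :: "(ell2 \<Rightarrow> ell2) \<Rightarrow> bool" where
  "compact_operator T \<longleftrightarrow> bounded_clinear T \<and> compact (closure (T ` cball 0 1))"

text \<open>
  \<open>S = A\<^sup>-\<^sup>1\<^sup>/\<^sup>2\<close>, i.e. \<open>S\<close> is the positive square root of the bounded everywhere defined operator
  \<open>A\<^sup>-\<^sup>1\<close>. Positive square roots are unique, so for given \<open>A\<close> at most one \<open>S\<close> satisfies this; for
  \<open>A = I + D\<^sup>*D\<close> with \<open>D\<close> closed and densely defined it exists.
\<close>

definition is_inverse_sqrt :: "(ell2 \<Rightarrow> ell2) \<Rightarrow> operator \<Rightarrow> bool" where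
  "is_inverse_sqrt S A \<longleftrightarrow> positive_operator S \<and> graph (S \<circ> S) = A\<inverse>"

definition compact_parametrices :: "operator \<Rightarrow> bool" where
  "compact_parametrices D \<longleftrightarrow> closed_densely_defined D \<and>
     (\<exists>S. is_inverse_sqrt S (op_plus Id (D O adjoint_op D)) \<and> compact_operator S) \<and>
     (\<exists>S. is_inverse_sqrt S (op_plus Id (adjoint_op D O D)) \<and> compact_operator S)"


section \<open>Diagonal and weighted shift operators\<close>

text \<open>The sequence \<open>k \<mapsto> \<beta>(k - 1)\<close>, with the convention \<open>\<beta>(-1) = 0\<close>.\<close>

definition pred_seq :: "(nat \<Rightarrow> complex) \<Rightarrow> nat \<Rightarrow> complex" where
  "pred_seq \<beta> k = (case k of 0 \<Rightarrow> 0 | Suc j \<Rightarrow> \<beta> j)"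

definition c_inc :: "(nat \<Rightarrow> complex) set" where
  "c_inc = {\<beta>. convergent (\<lambda>k. \<beta> k - pred_seq \<beta> k)}"

lift_definition shift :: "ell2 \<Rightarrow> ell2" is "\<lambda>x k. case k of 0 \<Rightarrow> 0 | Suc j \<Rightarrow> x j"
  by (subst summable_Suc_iff[symmetric]) simp

lemma shift_basis: "shift (basis k) = basis (Suc k)"
  by transfer (auto simp: fun_eq_iff split: nat.split)

text \<open>\<open>\<beta>(\<K>)\<close> on its maximal domain.\<close>

definition diag_op :: "(nat \<Rightarrow> complex) \<Rightarrow> operator" where
  "diag_op \<beta> = {(x, y). \<forall>k. coord y k = \<beta> k * coord x k}"

lemma diag_op_basis: "(basis k, scaleC (\<beta> k) (basis k)) \<in> diag_op \<beta>"
  unfolding diag_op_def by (simp add: basis.rep_eq scaleC.rep_eq)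

definition D_op :: "(nat \<Rightarrow> complex) \<Rightarrow> complex \<Rightarrow> operator" where
  "D_op \<beta> c =
     closure (restrict_op (op_plus (graph (scaleC c)) (diag_op (pred_seq \<beta>))) (ell2.span (range basis)))"

definition D_tilde_op :: "(nat \<Rightarrow> complex) \<Rightarrow> operator" where
  "D_tilde_op \<beta> = closure (restrict_op (diag_op \<beta> O graph shift) (ell2.span (range basis)))"

end

theory Submission
  imports Defs
begin

text \<open>
  Both operators are closed weighted shifts \<open>E\<^sub>k \<mapsto> w\<^sub>k E\<^bsub>k+m\<^esub>\<close> on their maximal domains, with \<open>m = 0\<close>
  and \<open>w\<^sub>k = c + \<beta>(k - 1)\<close> for the first one, and \<open>m = 1\<close> and \<open>w = \<beta>\<close> for the second one; the
  identification is possible because cutting off the coordinates of a point of the graph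
  approximates it by graph points over finite linear combinations of the \<open>E\<^sub>k\<close>
  (\<open>closure_restrict_weighted_shift\<close>). In either case \<open>w\<close> tends to infinity iff \<open>\<beta>\<close> does.

  For a weighted shift \<open>D\<close> the operators \<open>D\<^sup>*D\<close> and \<open>DD\<^sup>*\<close> are diagonal. The entries of \<open>D\<^sup>*D\<close> are
  \<open>|w\<^sub>k|\<^sup>2\<close>, and those of \<open>DD\<^sup>*\<close> are the same numbers preceded by \<open>m\<close> zeros. Everything therefore
  reduces to one fact about a diagonal operator with entries \<open>a\<^sub>k \<ge> 0\<close>: the inverse square root of
  \<open>I + diag a\<close> is compact iff \<open>a\<^sub>k \<rightarrow> \<infinity>\<close> (\<open>compact_inverse_sqrt_diag_iff\<close>).

  If \<open>a\<^sub>k \<rightarrow> \<infinity>\<close>, the inverse square root is the diagonal operator with entries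
  \<open>(1 + a\<^sub>k)\<^bsup>-1/2\<^esup> \<rightarrow> 0\<close>. Such an operator is compact since the unit ball is compact for the
  topology of coordinatewise convergence, on which the operator is continuous into the norm topology
  (\<open>compact_operator_diag_map\<close>). Conversely, if \<open>S\<close> is compact with
  \<open>S\<^sup>2 = (I + diag a)\<^sup>-\<^sup>1\<close>, then all vectors \<open>S\<^sup>2 E\<^sub>k = (1 + a\<^sub>k)\<^sup>-\<^sup>1 E\<^sub>k\<close> lie in one compact set; their
  only possible limit point along \<open>k \<rightarrow> \<infinity>\<close> is \<open>0\<close>, which forces \<open>a\<^sub>k \<rightarrow> \<infinity>\<close>. The
  argument uses \<open>S\<^sup>2\<close> because its values on the basis are prescribed by the definition of an inverse
  square root.
\<close>


section \<open>Coordinates and norm\<close>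

lemmas coord_simps = plus_ell2.rep_eq minus_ell2.rep_eq zero_ell2.rep_eq
  scaleR_ell2.rep_eq scaleC.rep_eq basis.rep_eq

lemma coord_sum: "coord (\<Sum>i\<in>A. f i) k = (\<Sum>i\<in>A. coord (f i) k)"
  by (induction A rule: infinite_finite_induct) (simp_all add: coord_simps)

lemma coord_sum_basis_shifted:
  "coord (\<Sum>k<N. scaleC (f k) (basis (k + m))) j = (if m \<le> j \<and> j < N + m then f (j - m) else 0)"
proof -
  have "coord (\<Sum>k<N. scaleC (f k) (basis (k + m))) j
      = (\<Sum>k<N. if k = j - m \<and> m \<le> j then f k else 0)"
    unfolding coord_sum by (intro sum.cong) (auto simp: coord_simps)
  also have "\<dots> = (if m \<le> j \<and> j < N + m then f (j - m) else 0)"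
    by (cases "m \<le> j") (auto simp: sum.delta)
  finally show ?thesis .
qed

lemmas coord_sum_basis = coord_sum_basis_shifted[where m = 0, simplified]

lemma norm_square: "(norm x)\<^sup>2 = (\<Sum>k. (cmod (coord x k))\<^sup>2)"
  unfolding norm_ell2_def by (simp add: suminf_nonneg summable_coord)

lemma summable_dominated:
  assumes "\<And>k. cmod (f k) \<le> M * cmod (coord x k)"
  shows "summable (\<lambda>k. (cmod (f k))\<^sup>2)"
proof (rule summable_comparison_test')
  show "summable (\<lambda>k. M\<^sup>2 * (cmod (coord x k))\<^sup>2)"
    by (intro summable_mult summable_coord)
  show "norm ((cmod (f k))\<^sup>2) \<le> M\<^sup>2 * (cmod (coord x k))\<^sup>2" for k
    using power_mono[OF assms[of k], of 2] by (simp add: power_mult_distrib)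
qed

lemma coord_Abs: "summable (\<lambda>k. (cmod (f k))\<^sup>2) \<Longrightarrow> coord (Abs_ell2 f) = f"
  by (simp add: Abs_ell2_inverse)

lemma norm_dominated:
  assumes "\<And>k. cmod (coord x k) \<le> M * cmod (coord y k)" "0 \<le> M"
  shows "norm x \<le> M * norm y"
proof (rule power2_le_imp_le)
  have "(norm x)\<^sup>2 \<le> (\<Sum>k. M\<^sup>2 * (cmod (coord y k))\<^sup>2)"
    unfolding norm_square
  proof (intro suminf_le summable_mult summable_coord)
    show "(cmod (coord x k))\<^sup>2 \<le> M\<^sup>2 * (cmod (coord y k))\<^sup>2" for k
      using power_mono[OF assms(1)[of k], of 2] by (simp add: power_mult_distrib)
  qed
  also have "\<dots> = (M * norm y)\<^sup>2"
    by (simp add: suminf_mult summable_coord power_mult_distrib norm_square)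
  finally show "(norm x)\<^sup>2 \<le> (M * norm y)\<^sup>2" .
qed (simp add: assms)

lemma norm_scaleC: "norm (scaleC c x) = cmod c * norm x"
  unfolding norm_ell2_def
  by (simp add: coord_simps norm_mult power_mult_distrib suminf_mult summable_coord real_sqrt_mult)

lemma norm_basis: "norm (basis k) = 1"
proof -
  have "(\<lambda>j. (cmod (coord (basis k) j))\<^sup>2) = (\<lambda>j. if j = k then 1 else 0)"
    by (auto simp: coord_simps)
  then have "(norm (basis k))\<^sup>2 = 1"
    unfolding norm_square using sums_single[of k "\<lambda>_. 1::real"] by (simp add: sums_iff)
  then show ?thesis by (simp add: power2_eq_1_iff) (metis norm_ge_zero le_minus_one_simps(3))
qed

lemma cmod_coord_le_norm: "cmod (coord x k) \<le> norm x"
proof (rule power2_le_imp_le)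
  have "(\<Sum>j\<in>{k}. (cmod (coord x j))\<^sup>2) \<le> (norm x)\<^sup>2"
    unfolding norm_square by (intro sum_le_suminf summable_coord) auto
  then show "(cmod (coord x k))\<^sup>2 \<le> (norm x)\<^sup>2" by simp
qed simp

lemma bounded_linear_coord: "bounded_linear (\<lambda>x. coord x k)"
  by (rule bounded_linear_intro[where K = 1])
     (auto simp: coord_simps scaleR_conv_of_real cmod_coord_le_norm)

lemmas continuous_on_coord [continuous_intros] =
  bounded_linear.continuous_on[OF bounded_linear_coord]
lemmas tendsto_coord = bounded_linear.tendsto[OF bounded_linear_coord]

lemma bounded_linear_scaleC_basis: "bounded_linear (\<lambda>c. scaleC c (basis k))"
proof (rule bounded_linear_intro[where K = 1])
  show "scaleC (r *\<^sub>R x) (basis k) = r *\<^sub>R scaleC x (basis k)" for r x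
    by (rule ell2_eqI) (simp add: coord_simps scaleR_conv_of_real)
qed (auto simp: ell2.scale_left_distrib norm_scaleC norm_basis)

text \<open>
  By Parseval, the squared distance of \<open>x\<close> to its \<open>N\<close>-th partial sum is the tail
  \<open>\<parallel>x\<parallel>\<^sup>2 - (|x\<^sub>0|\<^sup>2 + \<dots> + |x\<^bsub>N-1\<^esub>|\<^sup>2)\<close> of a convergent series.
\<close>

lemma basis_expansion: "(\<lambda>N. \<Sum>k<N. scaleC (coord x k) (basis k)) \<longlonglongrightarrow> x"
proof -
  define P where "P N = (\<Sum>k<N. scaleC (coord x k) (basis k))" for N
  have coord_P: "coord (P N) k = (if k < N then coord x k else 0)" for N k
    by (simp add: P_def coord_sum_basis)
  have "(norm (x - P N))\<^sup>2 = (norm x)\<^sup>2 - (\<Sum>k<N. (cmod (coord x k))\<^sup>2)" for N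
  proof -
    have "(norm (x - P N))\<^sup>2 = (\<Sum>k. (cmod (coord (x - P N) (k + N)))\<^sup>2)
        + (\<Sum>k<N. (cmod (coord (x - P N) k))\<^sup>2)"
      unfolding norm_square by (rule suminf_split_initial_segment[OF summable_coord])
    also have "\<dots> = (\<Sum>k. (cmod (coord x (k + N)))\<^sup>2)"
      by (simp add: coord_simps coord_P)
    also have "\<dots> = (norm x)\<^sup>2 - (\<Sum>k<N. (cmod (coord x k))\<^sup>2)"
      unfolding norm_square using suminf_split_initial_segment[OF summable_coord[of x], of N] by simp
    finally show ?thesis .
  qed
  moreover have "(\<lambda>N. (norm x)\<^sup>2 - (\<Sum>k<N. (cmod (coord x k))\<^sup>2)) \<longlonglongrightarrow> (norm x)\<^sup>2 - (norm x)\<^sup>2"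
    unfolding norm_square by (intro tendsto_intros summable_LIMSEQ summable_coord)
  ultimately have "(\<lambda>N. (norm (x - P N))\<^sup>2) \<longlonglongrightarrow> 0" by simp
  then have "(\<lambda>N. norm (x - P N)) \<longlonglongrightarrow> 0"
    using tendsto_real_sqrt by force
  then have "P \<longlonglongrightarrow> x"
    by (subst tendsto_dist_iff) (simp add: dist_norm norm_minus_commute)
  then show ?thesis by (simp add: P_def[abs_def])
qed

lemma sum_basis_in_span: "(\<Sum>k<N. scaleC (f k) (basis k)) \<in> ell2.span (range basis)"
  by (intro ell2.span_sum ell2.span_scale ell2.span_base) auto


section \<open>Compactness of diagonal operators\<close>

text \<open>
  The everywhere defined counterpart of \<^const>\<open>diag_op\<close>. It is meaningful for bounded \<open>t\<close> only:
  otherwise \<^const>\<open>Abs_ell2\<close> may be applied to a sequence that is not square-summable.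
\<close>

definition diag_map :: "(nat \<Rightarrow> complex) \<Rightarrow> ell2 \<Rightarrow> ell2" where
  "diag_map t x = Abs_ell2 (\<lambda>k. t k * coord x k)"

lemma coord_diag_map:
  assumes "\<And>k. cmod (t k) \<le> M"
  shows "coord (diag_map t x) k = t k * coord x k"
proof -
  have "summable (\<lambda>k. (cmod (t k * coord x k))\<^sup>2)"
    by (rule summable_dominated[where M = M and x = x])
       (simp add: norm_mult mult_right_mono assms)
  then show ?thesis by (simp add: diag_map_def coord_Abs)
qed

lemma bounded_clinear_diag_map:
  assumes t: "\<And>k. cmod (t k) \<le> M"
  shows "bounded_clinear (diag_map t)"
  unfolding bounded_clinear_def
proof
  have "0 \<le> M" using norm_ge_zero[of "t 0"] t[of 0] by linarith
  note coords = coord_diag_map[OF t] coord_simps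
  show "bounded_linear (diag_map t)"
  proof (rule bounded_linear_intro[where K = M])
    show "norm (diag_map t x) \<le> norm x * M" for x
      using norm_dominated[of "diag_map t x" M x] \<open>0 \<le> M\<close>
      by (simp add: coords norm_mult mult_right_mono t mult.commute)
  qed (rule ell2_eqI, simp add: coords algebra_simps)+
  show "\<forall>a x. diag_map t (scaleC a x) = scaleC a (diag_map t x)"
    by (intro allI ell2_eqI) (simp add: coords)
qed

text \<open>
  Compactness is meant in the product topology on \<^typ>\<open>nat \<Rightarrow> complex\<close>. Requiring
  \<open>|f\<^sub>0|\<^sup>2 + \<dots> + |f\<^bsub>n-1\<^esub>|\<^sup>2 \<le> 1\<close> for every \<open>n\<close> describes the unit ball by closed conditions that involve
  finitely many coordinates each, so it is a closed subset of a product of closed unit discs, which is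
  compact by Tychonoff's theorem.
\<close>

lemma compact_coord_unit_ball: "compact (coord ` cball 0 1)"
proof -
  have "coord ` cball 0 1 = {f. \<forall>n. (\<Sum>k<n. (cmod (f k))\<^sup>2) \<le> 1}" (is "_ = ?B")
  proof (intro equalityI subsetI)
    fix f assume "f \<in> coord ` cball 0 1"
    then obtain x where x: "f = coord x" "norm x \<le> 1" by auto
    have "(\<Sum>k<n. (cmod (f k))\<^sup>2) \<le> (norm x)\<^sup>2" for n
      unfolding norm_square x(1) by (intro sum_le_suminf summable_coord) auto
    then show "f \<in> ?B" using x(2) by (force intro: order_trans power_le_one)
  next
    fix f assume f: "f \<in> ?B"
    have sm: "summable (\<lambda>k. (cmod (f k))\<^sup>2)"
      using f by (intro summableI_nonneg_bounded[where x = 1]) auto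
    have "(norm (Abs_ell2 f))\<^sup>2 \<le> 1"
      unfolding norm_square coord_Abs[OF sm] using f by (intro suminf_le_const sm) auto
    then have "Abs_ell2 f \<in> cball 0 1" by (simp add: power_le_one_iff)
    then show "f \<in> coord ` cball 0 1" using coord_Abs[OF sm] by (metis imageI)
  qed
  moreover have "compact ?B"
  proof -
    have "compact (PiE UNIV (\<lambda>_::nat. cball (0::complex) 1))"
      using compactin_PiE[of "\<lambda>_::nat. euclidean :: complex topology" UNIV "\<lambda>_. cball 0 1"]
      by (simp add: euclidean_product_topology)
    moreover have "closed ?B"
      by (intro closed_Collect_all closed_Collect_le continuous_intros continuous_on_product_coordinates)
    moreover have "?B \<subseteq> PiE UNIV (\<lambda>_. cball 0 1)"
    proof
      fix f assume f: "f \<in> ?B"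
      have "(cmod (f k))\<^sup>2 \<le> (\<Sum>j<Suc k. (cmod (f j))\<^sup>2)" for k
        by (simp add: sum_nonneg)
      then have "(cmod (f k))\<^sup>2 \<le> 1" for k using f order_trans by blast
      then show "f \<in> PiE UNIV (\<lambda>_. cball 0 1)" by (auto simp: power_le_one_iff)
    qed
    ultimately show ?thesis
      using compact_Int_closed[of "PiE UNIV (\<lambda>_. cball 0 1)" ?B] by (simp only: Int_absorb1)
  qed
  ultimately show ?thesis by simp
qed

text \<open>
  On the unit ball with the product topology, the operator is a uniform limit of its finite
  truncations, because the error after \<open>N\<close> terms is at most the supremum of \<open>|t\<^sub>k|\<close> over \<open>k \<ge> N\<close>.
  Each truncation depends on finitely many coordinates and hence is continuous, so the limit is
  continuous too, and the image of the unit ball is the continuous image of a compact set. In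
  particular that image is already closed.
\<close>

lemma compact_operator_diag_map:
  assumes t: "t \<longlonglongrightarrow> 0"
  shows "compact_operator (diag_map t)"
proof -
  obtain M where M: "\<And>k. cmod (t k) \<le> M"
    using t by (metis Bseq_eq_bounded convergentI convergent_imp_Bseq BseqE)
  let ?B = "coord ` cball 0 1"
  have "uniform_limit ?B (\<lambda>N f. \<Sum>k<N. scaleC (t k * f k) (basis k)) (\<lambda>f. diag_map t (Abs_ell2 f))
      sequentially"
  proof (rule uniform_limitI)
    fix e :: real assume e: "0 < e"
    have "\<forall>\<^sub>F k in sequentially. cmod (t k) < e / 2"
      using t half_gt_zero[OF e] unfolding tendsto_iff by (simp only: dist_norm diff_zero)
    then obtain N0 where N0: "\<And>k. k \<ge> N0 \<Longrightarrow> cmod (t k) < e / 2"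
      unfolding eventually_sequentially by blast
    have "dist (\<Sum>k<N. scaleC (t k * f k) (basis k)) (diag_map t (Abs_ell2 f)) < e"
      if N: "N \<ge> N0" and f: "f \<in> ?B" for N f
    proof -
      obtain x where x: "f = coord x" "norm x \<le> 1" using f by auto
      let ?d = "(\<Sum>k<N. scaleC (t k * f k) (basis k)) - diag_map t (Abs_ell2 f)"
      have "coord ?d k = (if k < N then 0 else - (t k * coord x k))" for k
        by (simp add: coord_simps coord_sum_basis coord_diag_map[OF M] x coord_inverse)
      then have "cmod (coord ?d k) \<le> e / 2 * cmod (coord x k)" for k
        using mult_right_mono[of "cmod (t k)" "e / 2" "cmod (coord x k)"] N0[of k] N e
        by (cases "k < N") (simp_all add: norm_mult)
      then have "norm ?d \<le> e / 2 * norm x" using e by (intro norm_dominated) auto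
      also have "\<dots> \<le> e / 2 * 1" using x(2) e by (intro mult_left_mono) auto
      finally show ?thesis using e by (simp add: dist_norm)
    qed
    then show "\<forall>\<^sub>F N in sequentially. \<forall>f\<in>?B.
        dist (\<Sum>k<N. scaleC (t k * f k) (basis k)) (diag_map t (Abs_ell2 f)) < e"
      unfolding eventually_sequentially by blast
  qed
  moreover have "continuous_on ?B (\<lambda>f. \<Sum>k<N. scaleC (t k * f k) (basis k))" for N
    by (intro continuous_intros bounded_linear.continuous_on[OF bounded_linear_scaleC_basis]
        continuous_on_subset[OF continuous_on_product_coordinates]) auto
  ultimately have "continuous_on ?B (\<lambda>f. diag_map t (Abs_ell2 f))"
    by (intro uniform_limit_theorem) auto
  then have "compact ((\<lambda>f. diag_map t (Abs_ell2 f)) ` ?B)"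
    by (intro compact_continuous_image compact_coord_unit_ball)
  then have "compact (diag_map t ` cball 0 1)"
    by (simp add: image_image coord_inverse)
  then show ?thesis
    unfolding compact_operator_def
    using bounded_clinear_diag_map[OF M] by (simp add: compact_imp_closed closure_closed)
qed

text \<open>
  If infinitely many \<open>|t\<^sub>k|\<close> were at least \<open>e > 0\<close>, a subsequence of the corresponding vectors would
  converge in norm. Every fixed coordinate is eventually \<open>0\<close> along it, so the limit is \<open>0\<close>, although
  all the vectors have norm at least \<open>e\<close>.
\<close>

lemma compact_multiples_of_basis_tendsto_0:
  assumes K: "compact K" and in_K: "\<And>k. scaleC (t k) (basis k) \<in> K"
  shows "t \<longlonglongrightarrow> 0"
proof (rule ccontr)
  assume "\<not> t \<longlonglongrightarrow> 0"
  then obtain e where e: "e > 0" "\<exists>\<^sub>F k in sequentially. e \<le> cmod (t k)"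
    unfolding tendsto_iff by (auto simp: dist_norm not_eventually not_less)
  then have "infinite {k. e \<le> cmod (t k)}"
    by (simp add: frequently_sequentially infinite_nat_iff_unbounded_le)
  then obtain r :: "nat \<Rightarrow> nat" where r: "strict_mono r" "\<forall>n. r n \<in> {k. e \<le> cmod (t k)}"
    using infinite_enumerate by blast
  define z where "z n = scaleC (t (r n)) (basis (r n))" for n
  have "\<forall>n. z n \<in> K" using in_K by (simp add: z_def)
  then obtain l s where s: "strict_mono s" "(z \<circ> s) \<longlonglongrightarrow> l"
    using compact_imp_seq_compact[OF K] by (meson seq_compactE)
  have "coord l k = 0" for k
  proof -
    have "\<forall>\<^sub>F n in sequentially. coord ((z \<circ> s) n) k = 0"
      unfolding eventually_sequentially
    proof (intro exI allI impI)
      fix n assume "n \<ge> Suc k"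
      then have "r (s n) \<noteq> k"
        using seq_suble[OF r(1), of "s n"] seq_suble[OF s(1), of n]
        by linarith
      then show "coord ((z \<circ> s) n) k = 0" by (simp add: z_def coord_simps)
    qed
    then have "(\<lambda>n. coord ((z \<circ> s) n) k) \<longlonglongrightarrow> 0" by (rule tendsto_eventually)
    then show ?thesis using LIMSEQ_unique tendsto_coord[OF s(2)] by blast
  qed
  then have "l = 0" by (intro ell2_eqI) (simp add: coord_simps)
  then have "(\<lambda>n. norm ((z \<circ> s) n)) \<longlonglongrightarrow> 0" using s(2) tendsto_norm_zero by blast
  moreover have "e \<le> norm ((z \<circ> s) n)" for n
    using r(2) by (simp add: z_def norm_scaleC norm_basis)
  ultimately have "e \<le> 0" by (intro LIMSEQ_le_const) auto
  then show False using e by simp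
qed

text \<open>
  If \<open>\<parallel>S\<parallel> \<le> M\<close>, then \<open>S\<close> maps \<open>E\<^sub>k\<close> into the ball of radius \<open>M\<close>, so \<open>S\<^sup>2 E\<^sub>k\<close> lies in \<open>M\<close> times the compact
  closure of the image of the unit ball.
\<close>

lemma compact_square_diag_tendsto_0:
  assumes S: "compact_operator S" and sq: "\<And>k. S (S (basis k)) = scaleC (t k) (basis k)"
  shows "t \<longlonglongrightarrow> 0"
proof -
  have bl: "bounded_linear S" and comp: "compact (closure (S ` cball 0 1))"
    using S by (auto simp: compact_operator_def bounded_clinear_def)
  obtain M where M: "M > 0" "\<And>x. norm (S x) \<le> norm x * M"
    using bounded_linear.pos_bounded[OF bl] by blast
  show ?thesis
  proof (rule compact_multiples_of_basis_tendsto_0[OF compact_scaling[OF comp, of M]])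
    fix k
    have "norm (S (basis k)) \<le> M" using M(2)[of "basis k"] by (simp add: norm_basis)
    then have "(1 / M) *\<^sub>R S (basis k) \<in> cball 0 1" using M(1) by (simp add: divide_simps)
    then have "S ((1 / M) *\<^sub>R S (basis k)) \<in> closure (S ` cball 0 1)"
      by (intro subsetD[OF closure_subset] imageI)
    moreover have "scaleC (t k) (basis k) = M *\<^sub>R S ((1 / M) *\<^sub>R S (basis k))"
      using M(1) by (simp add: linear_scale[OF bounded_linear.linear[OF bl]] sq)
    ultimately show "scaleC (t k) (basis k) \<in> (*\<^sub>R) M ` closure (S ` cball 0 1)" by blast
  qed
qed

text \<open>
  The analytic core. No particular form of \<open>S\<close> is known in the direction from left to right; only
  \<open>S\<^sup>2 E\<^sub>k = (1 + a\<^sub>k)\<^sup>-\<^sup>1 E\<^sub>k\<close> is extracted from \<open>S\<^sup>2\<close> being the inverse.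
\<close>

lemma compact_inverse_sqrt_diag_iff:
  fixes a :: "nat \<Rightarrow> real"
  assumes a: "\<And>k. 0 \<le> a k"
  shows "(\<exists>S. is_inverse_sqrt S (op_plus Id (diag_op (\<lambda>k. of_real (a k)))) \<and> compact_operator S)
    \<longleftrightarrow> filterlim a at_top sequentially" (is "?L \<longleftrightarrow> ?R")
proof -
  let ?A = "op_plus Id (diag_op (\<lambda>k. of_real (a k)))"
  have A: "(y, x) \<in> ?A \<longleftrightarrow> (\<forall>k. coord x k = of_real (1 + a k) * coord y k)" for x y
  proof
    assume "(y, x) \<in> ?A"
    then show "\<forall>k. coord x k = of_real (1 + a k) * coord y k"
      by (auto simp: op_plus_def diag_op_def coord_simps algebra_simps)
  next
    assume "\<forall>k. coord x k = of_real (1 + a k) * coord y k"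
    then have "(y, x - y) \<in> diag_op (\<lambda>k. of_real (a k))"
      by (simp add: diag_op_def coord_simps algebra_simps)
    moreover have "x = y + (x - y)" by simp
    ultimately show "(y, x) \<in> ?A" unfolding op_plus_def by blast
  qed
  have pos: "0 < 1 + a k" for k using a[of k] by linarith
  then have nz: "complex_of_real (1 + a k) \<noteq> 0" for k by (metis less_irrefl of_real_eq_0_iff)
  show ?thesis
  proof
    assume ?L
    then obtain S where gr: "graph (S \<circ> S) = ?A\<inverse>" and S: "compact_operator S"
      by (auto simp: is_inverse_sqrt_def)
    have "S (S (basis k)) = scaleC (of_real (1 / (1 + a k))) (basis k)" for k
    proof -
      have "(basis k, S (S (basis k))) \<in> graph (S \<circ> S)" by (auto simp: graph_def)
      then have *: "coord (basis k) j = of_real (1 + a j) * coord (S (S (basis k))) j" for j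
        unfolding gr by (simp add: A)
      show ?thesis
      proof (rule ell2_eqI)
        fix j
        have "coord (S (S (basis k))) j = coord (basis k) j / of_real (1 + a j)"
          using *[of j] nz[of j] by (simp add: field_simps)
        then show "coord (S (S (basis k))) j = coord (scaleC (of_real (1 / (1 + a k))) (basis k)) j"
          by (auto simp: coord_simps)
      qed
    qed
    then have "(\<lambda>k. complex_of_real (1 / (1 + a k))) \<longlonglongrightarrow> 0"
      by (rule compact_square_diag_tendsto_0[OF S])
    then have "(\<lambda>k. inverse (1 + a k)) \<longlonglongrightarrow> 0"
      using tendsto_of_real_iff[of "\<lambda>k. inverse (1 + a k)" 0 sequentially, where ?'a = complex]
      by (simp add: inverse_eq_divide)
    then have "filterlim (\<lambda>k. 1 + a k) at_top sequentially"
      using filterlim_inverse_at_top_iff[of "\<lambda>k. inverse (1 + a k)" sequentially] pos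
      by (simp add: filterlim_at eventually_mono at_within_def)
    then show ?R
      using filterlim_tendsto_add_at_top[OF tendsto_const[of "-1"]] by fastforce
  next
    assume ?R
    define t where "t k = complex_of_real (1 / sqrt (1 + a k))" for k
    have t_sq: "t k * t k = of_real (1 / (1 + a k))" for k
      using pos[of k] by (simp add: t_def flip: of_real_mult of_real_divide)
    have t_le: "cmod (t k) \<le> 1" for k
      using a[of k] by (simp add: t_def norm_divide)
    note coord_S = coord_diag_map[OF t_le]
    have "filterlim (\<lambda>k. sqrt (1 + a k)) at_top sequentially"
      by (intro filterlim_compose[OF sqrt_at_top] filterlim_tendsto_add_at_top[OF tendsto_const \<open>?R\<close>])
    then have "(\<lambda>k. 1 / sqrt (1 + a k)) \<longlonglongrightarrow> 0"
      by (intro real_tendsto_divide_at_top[OF tendsto_const])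
    then have "t \<longlonglongrightarrow> 0"
      unfolding t_def[abs_def] by (metis of_real_0 tendsto_of_real)
    then have "compact_operator (diag_map t)" by (rule compact_operator_diag_map)
    moreover have "is_inverse_sqrt (diag_map t) ?A"
      unfolding is_inverse_sqrt_def positive_operator_def
    proof (intro conjI allI)
      show "bounded_clinear (diag_map t)" by (rule bounded_clinear_diag_map[OF t_le])
      fix x
      have pt: "cnj (coord x k) * coord (diag_map t x) k
          = of_real ((1 / sqrt (1 + a k)) * (cmod (coord x k))\<^sup>2)" for k
        unfolding of_real_mult complex_norm_square by (simp add: coord_S t_def)
      have "summable (\<lambda>k. (1 / sqrt (1 + a k)) * (cmod (coord x k))\<^sup>2)"
      proof (rule summable_comparison_test'[OF summable_coord])
        show "norm ((1 / sqrt (1 + a k)) * (cmod (coord x k))\<^sup>2) \<le> (cmod (coord x k))\<^sup>2" for k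
          using mult_right_mono[OF t_le[of k], of "(cmod (coord x k))\<^sup>2"] by (simp add: t_def norm_divide abs_mult)
      qed
      then have "cinner x (diag_map t x) = of_real (\<Sum>k. (1 / sqrt (1 + a k)) * (cmod (coord x k))\<^sup>2)"
          and "0 \<le> (\<Sum>k. (1 / sqrt (1 + a k)) * (cmod (coord x k))\<^sup>2)"
        unfolding cinner_def pt using pos
        by (simp_all only: suminf_of_real) (auto intro!: suminf_nonneg simp: less_imp_le)
      then show "cinner x (diag_map t x) \<in> \<real>\<^sub>\<ge>\<^sub>0" by simp
    next
      have "y = diag_map t (diag_map t x) \<longleftrightarrow> (y, x) \<in> ?A" for x y
      proof -
        have "y = diag_map t (diag_map t x) \<longleftrightarrow> (\<forall>k. coord y k = of_real (1 / (1 + a k)) * coord x k)"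
          by (auto simp: coord_S mult.assoc[symmetric] t_sq intro: ell2_eqI)
        also have "\<dots> \<longleftrightarrow> (y, x) \<in> ?A"
          unfolding A
        proof (intro all_cong1)
          show "(coord y k = of_real (1 / (1 + a k)) * coord x k)
              = (coord x k = of_real (1 + a k) * coord y k)" for k
            using nz[of k] by (auto simp: field_simps)
        qed
        finally show ?thesis .
      qed
      then show "graph (diag_map t \<circ> diag_map t) = ?A\<inverse>"
        by (auto simp: graph_def)
    qed
    ultimately show ?L by blast
  qed
qed


section \<open>Weighted shifts\<close>

text \<open>
  The operator \<open>E\<^sub>k \<mapsto> w\<^sub>k E\<^bsub>k+m\<^esub>\<close> on its maximal domain. The parameter \<open>m\<close> treats diagonal operators
  (\<open>m = 0\<close>) and unilateral weighted shifts (\<open>m = 1\<close>) at once.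
\<close>

definition weighted_shift :: "nat \<Rightarrow> (nat \<Rightarrow> complex) \<Rightarrow> operator" where
  "weighted_shift m w =
     {(x, y). \<forall>j. coord y j = (if j < m then 0 else w (j - m) * coord x (j - m))}"

lemma weighted_shift_iff:
  "(x, y) \<in> weighted_shift m w
    \<longleftrightarrow> (\<forall>j. coord y j = (if j < m then 0 else w (j - m) * coord x (j - m)))"
  by (simp add: weighted_shift_def)

lemma weighted_shift_basis: "(basis k, scaleC (w k) (basis (k + m))) \<in> weighted_shift m w"
  by (auto simp: weighted_shift_def coord_simps)

lemma closed_weighted_shift: "closed (weighted_shift m w)"
proof -
  have "closed {p. \<forall>j. coord (snd p) j = (if j < m then 0 else w (j - m) * coord (fst p) (j - m))}"
  proof (intro closed_Collect_all closed_Collect_eq continuous_intros)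
    show "continuous_on UNIV (\<lambda>p::ell2\<times>ell2. if j < m then 0 else w (j - m) * coord (fst p) (j - m))" for j
      by (cases "j < m") (auto intro!: continuous_intros)
  qed
  then show ?thesis by (simp add: weighted_shift_def case_prod_unfold)
qed

text \<open>
  The finite linear combinations of the \<open>E\<^sub>k\<close> form a core: if \<open>y\<close> is the image of \<open>x\<close>, then the
  truncation of \<open>y\<close> after \<open>N + m\<close> coordinates is the image of the truncation of \<open>x\<close> after \<open>N\<close>
  coordinates, and both converge.
\<close>

lemma closure_restrict_weighted_shift:
  "closure (restrict_op (weighted_shift m w) (ell2.span (range basis))) = weighted_shift m w"
    (is "closure ?R = _")
proof
  show "closure ?R \<subseteq> weighted_shift m w"
    by (intro closure_minimal closed_weighted_shift) (auto simp: restrict_op_def)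
  show "weighted_shift m w \<subseteq> closure ?R"
  proof (rule subrelI)
    fix x y assume xy: "(x, y) \<in> weighted_shift m w"
    define p where "p N = (\<Sum>k<N. scaleC (coord x k) (basis k), \<Sum>k<N+m. scaleC (coord y k) (basis k))" for N
    have "p \<longlonglongrightarrow> (x, y)"
      unfolding p_def
      by (intro tendsto_Pair basis_expansion LIMSEQ_ignore_initial_segment[OF basis_expansion])
    moreover have "p N \<in> ?R" for N
      using xy unfolding p_def restrict_op_def
      by (auto simp: sum_basis_in_span weighted_shift_def coord_sum_basis)
    ultimately show "(x, y) \<in> closure ?R" unfolding closure_sequential by blast
  qed
qed

lemma closed_densely_defined_weighted_shift: "closed_densely_defined (weighted_shift m w)"
  unfolding closed_densely_defined_def
proof (intro conjI closed_weighted_shift)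
  have "single_valued (weighted_shift m w)"
    by (rule single_valuedI) (simp add: weighted_shift_iff ell2_eqI)
  then show "linear_operator (weighted_shift m w)"
    unfolding linear_operator_def by (auto simp: weighted_shift_iff coord_simps algebra_simps)
  show "closure (Domain (weighted_shift m w)) = UNIV"
  proof -
    have "x \<in> closure (Domain (weighted_shift m w))" for x
    proof -
      have "(\<Sum>k<N. scaleC (coord x k) (basis k), \<Sum>k<N. scaleC (w k * coord x k) (basis (k + m)))
          \<in> weighted_shift m w" for N
        by (auto simp: weighted_shift_def coord_sum_basis coord_sum_basis_shifted)
      then have "(\<Sum>k<N. scaleC (coord x k) (basis k)) \<in> Domain (weighted_shift m w)" for N
        by blast
      then show ?thesis
        unfolding closure_sequential
        by (intro exI[of _ "\<lambda>N. \<Sum>k<N. scaleC (coord x k) (basis k)"] conjI allI basis_expansion)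
    qed
    then show ?thesis by blast
  qed
qed

lemma cinner_basis: "cinner x (basis k) = cnj (coord x k)"
proof -
  have "(\<lambda>j. cnj (coord x j) * coord (basis k) j) = (\<lambda>j. if j = k then cnj (coord x j) else 0)"
    by (auto simp: coord_simps)
  then show ?thesis
    unfolding cinner_def using sums_single[of k "\<lambda>j. cnj (coord x j)"] by (simp add: sums_iff)
qed

lemma cinner_scaleC_right: "cinner x (scaleC a y) = a * cinner x y"
proof -
  have "summable (\<lambda>k. cnj (coord x k) * coord y k)"
    by (intro summable_cnj_mult summable_coord)
  then show ?thesis
    unfolding cinner_def by (simp add: coord_simps suminf_mult[symmetric] mult.left_commute)
qed

text \<open>
  The adjoint, too, has its maximal domain. Testing the defining identity on \<open>E\<^sub>k\<close> yields the
  coordinates of \<open>z\<close>; the converse is a shift of the summation index, where the first \<open>m\<close> terms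
  vanish.
\<close>

lemma adjoint_weighted_shift_iff:
  "(y, z) \<in> adjoint_op (weighted_shift m w) \<longleftrightarrow> (\<forall>k. coord z k = cnj (w k) * coord y (k + m))"
proof
  assume yz: "(y, z) \<in> adjoint_op (weighted_shift m w)"
  show "\<forall>k. coord z k = cnj (w k) * coord y (k + m)"
  proof
    fix k
    have "cinner y (scaleC (w k) (basis (k + m))) = cinner z (basis k)"
      using yz weighted_shift_basis unfolding adjoint_op_def by fastforce
    then have "cnj (coord z k) = w k * cnj (coord y (k + m))"
      by (simp add: cinner_scaleC_right cinner_basis)
    then show "coord z k = cnj (w k) * coord y (k + m)" by (metis complex_cnj_cnj complex_cnj_mult)
  qed
next
  assume z: "\<forall>k. coord z k = cnj (w k) * coord y (k + m)"
  have "cinner y v = cinner z x" if "(x, v) \<in> weighted_shift m w" for x v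
  proof -
    have v: "coord v j = (if j < m then 0 else w (j - m) * coord x (j - m))" for j
      using that by (simp add: weighted_shift_def)
    have "summable (\<lambda>j. cnj (coord y j) * coord v j)"
      by (intro summable_cnj_mult summable_coord)
    from suminf_split_initial_segment[OF this, of m]
    have "cinner y v = (\<Sum>k. cnj (coord y (k + m)) * coord v (k + m))"
      by (simp add: cinner_def v)
    also have "\<dots> = cinner z x"
      by (simp add: cinner_def v z mult_ac)
    finally show ?thesis .
  qed
  then show "(y, z) \<in> adjoint_op (weighted_shift m w)"
    unfolding adjoint_op_def by blast
qed

text \<open>
  That the product \<open>D\<^sup>*D\<close> has the full domain of the diagonal operator needs an intermediate vector
  \<open>D x\<close>, which is square-summable because \<open>|w\<^sub>k x\<^sub>k|\<^sup>2 = ||w\<^sub>k|\<^sup>2 x\<^sub>k| |x\<^sub>k| \<le> ||w\<^sub>k|\<^sup>2 x\<^sub>k|\<^sup>2 + |x\<^sub>k|\<^sup>2\<close>. The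
  product \<open>DD\<^sup>*\<close> is treated by the same estimate.
\<close>

lemma adjoint_comp_weighted_shift:
  "weighted_shift m w O adjoint_op (weighted_shift m w) = diag_op (\<lambda>k. of_real ((cmod (w k))\<^sup>2))"
proof (intro equalityI subrelI)
  fix x z assume "(x, z) \<in> weighted_shift m w O adjoint_op (weighted_shift m w)"
  then show "(x, z) \<in> diag_op (\<lambda>k. of_real ((cmod (w k))\<^sup>2))"
    by (auto simp: adjoint_weighted_shift_iff weighted_shift_iff diag_op_def complex_norm_square
        simp del: of_real_power)
next
  fix x z assume "(x, z) \<in> diag_op (\<lambda>k. of_real ((cmod (w k))\<^sup>2))"
  then have z: "\<And>k. coord z k = of_real ((cmod (w k))\<^sup>2) * coord x k" by (simp add: diag_op_def)
  have "summable (\<lambda>k. (cmod (w k * coord x k))\<^sup>2)"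
  proof (rule summable_comparison_test'[OF summable_add[OF summable_coord[of z] summable_coord[of x]]])
    show "norm ((cmod (w k * coord x k))\<^sup>2) \<le> (cmod (coord z k))\<^sup>2 + (cmod (coord x k))\<^sup>2" for k
      using cmod_mult_le_squares[of "cnj (coord z k)" "coord x k"]
      by (simp add: z norm_mult power_mult_distrib power2_eq_square mult_ac)
  qed
  then have "summable (\<lambda>j. (cmod (if j < m then 0 else w (j - m) * coord x (j - m)))\<^sup>2)"
    by (subst summable_iff_shift[of _ m, symmetric]) simp
  then have "(x, Abs_ell2 (\<lambda>j. if j < m then 0 else w (j - m) * coord x (j - m))) \<in> weighted_shift m w"
    and "(Abs_ell2 (\<lambda>j. if j < m then 0 else w (j - m) * coord x (j - m)), z)
      \<in> adjoint_op (weighted_shift m w)"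
    by (auto simp: weighted_shift_iff adjoint_weighted_shift_iff coord_Abs z complex_norm_square mult_ac
        simp del: of_real_power)
  then show "(x, z) \<in> weighted_shift m w O adjoint_op (weighted_shift m w)" by blast
qed

lemma weighted_shift_comp_adjoint:
  "adjoint_op (weighted_shift m w) O weighted_shift m w
    = diag_op (\<lambda>j. of_real (if j < m then 0 else (cmod (w (j - m)))\<^sup>2))"
proof (intro equalityI subrelI)
  fix y u assume "(y, u) \<in> adjoint_op (weighted_shift m w) O weighted_shift m w"
  then show "(y, u) \<in> diag_op (\<lambda>j. of_real (if j < m then 0 else (cmod (w (j - m)))\<^sup>2))"
    by (auto simp: adjoint_weighted_shift_iff weighted_shift_iff diag_op_def complex_norm_square
        simp del: of_real_power)
next
  fix y u assume "(y, u) \<in> diag_op (\<lambda>j. of_real (if j < m then 0 else (cmod (w (j - m)))\<^sup>2))"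
  then have u: "\<And>j. coord u j = of_real (if j < m then 0 else (cmod (w (j - m)))\<^sup>2) * coord y j"
    by (simp add: diag_op_def)
  have "summable (\<lambda>k. (cmod (cnj (w k) * coord y (k + m)))\<^sup>2)"
  proof (rule summable_comparison_test'[OF summable_add])
    show "summable (\<lambda>k. (cmod (coord u (k + m)))\<^sup>2)" "summable (\<lambda>k. (cmod (coord y (k + m)))\<^sup>2)"
      using summable_coord by (auto intro: summable_ignore_initial_segment)
    show "norm ((cmod (cnj (w k) * coord y (k + m)))\<^sup>2)
        \<le> (cmod (coord u (k + m)))\<^sup>2 + (cmod (coord y (k + m)))\<^sup>2" for k
      using cmod_mult_le_squares[of "cnj (coord u (k + m))" "coord y (k + m)"]
      by (simp add: u norm_mult power_mult_distrib power2_eq_square mult_ac)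
  qed
  then have "(y, Abs_ell2 (\<lambda>k. cnj (w k) * coord y (k + m))) \<in> adjoint_op (weighted_shift m w)"
    and "(Abs_ell2 (\<lambda>k. cnj (w k) * coord y (k + m)), u) \<in> weighted_shift m w"
    by (auto simp: weighted_shift_iff adjoint_weighted_shift_iff coord_Abs u complex_norm_square mult_ac
        simp del: of_real_power)
  then show "(y, u) \<in> adjoint_op (weighted_shift m w) O weighted_shift m w" by blast
qed

text \<open>
  The \<open>m\<close> leading zeros among the entries of \<open>DD\<^sup>*\<close> do not affect divergence, so the two compactness
  conditions coincide.
\<close>

lemma compact_parametrices_weighted_shift_iff:
  "compact_parametrices (weighted_shift m w) \<longleftrightarrow> filterlim w at_infinity sequentially"
proof -
  have sq: "filterlim (\<lambda>k. (cmod (w k))\<^sup>2) at_top sequentially \<longleftrightarrow> filterlim w at_infinity sequentially"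
  proof
    assume "filterlim (\<lambda>k. (cmod (w k))\<^sup>2) at_top sequentially"
    then have "filterlim (\<lambda>k. sqrt ((cmod (w k))\<^sup>2)) at_top sequentially"
      by (rule filterlim_compose[OF sqrt_at_top])
    then show "filterlim w at_infinity sequentially"
      by (simp add: filterlim_at_infinity_conv_norm_at_top)
  next
    assume "filterlim w at_infinity sequentially"
    then show "filterlim (\<lambda>k. (cmod (w k))\<^sup>2) at_top sequentially"
      by (simp add: filterlim_at_infinity_conv_norm_at_top filterlim_pow_at_top)
  qed
  have shifted: "filterlim (\<lambda>j. if j < m then 0 else (cmod (w (j - m)))\<^sup>2) at_top sequentially
      \<longleftrightarrow> filterlim (\<lambda>k. (cmod (w k))\<^sup>2) at_top sequentially"
    unfolding filterlim_iff
    by (subst eventually_sequentially_seg[of _ m, symmetric]) simp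
  show ?thesis
    unfolding compact_parametrices_def adjoint_comp_weighted_shift weighted_shift_comp_adjoint
    by (subst (1 2) compact_inverse_sqrt_diag_iff)
       (auto simp: closed_densely_defined_weighted_shift shifted sq)
qed


section \<open>The implementations of the two derivations\<close>

lemma D_op_eq_weighted_shift: "D_op \<beta> c = weighted_shift 0 (\<lambda>k. c + pred_seq \<beta> k)"
proof -
  have "op_plus (graph (scaleC c)) (diag_op (pred_seq \<beta>)) = weighted_shift 0 (\<lambda>k. c + pred_seq \<beta> k)"
  proof (intro equalityI subrelI)
    fix x y assume "(x, y) \<in> op_plus (graph (scaleC c)) (diag_op (pred_seq \<beta>))"
    then show "(x, y) \<in> weighted_shift 0 (\<lambda>k. c + pred_seq \<beta> k)"
      by (auto simp: op_plus_def graph_def diag_op_def weighted_shift_def coord_simps algebra_simps)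
  next
    fix x y assume "(x, y) \<in> weighted_shift 0 (\<lambda>k. c + pred_seq \<beta> k)"
    then have "(x, y - scaleC c x) \<in> diag_op (pred_seq \<beta>)"
      by (auto simp: diag_op_def weighted_shift_def coord_simps algebra_simps)
    moreover have "(x, scaleC c x) \<in> graph (scaleC c)" by (auto simp: graph_def)
    moreover have "y = scaleC c x + (y - scaleC c x)" by simp
    ultimately show "(x, y) \<in> op_plus (graph (scaleC c)) (diag_op (pred_seq \<beta>))"
      unfolding op_plus_def by blast
  qed
  then show ?thesis by (simp add: D_op_def closure_restrict_weighted_shift)
qed

lemma D_tilde_op_eq_weighted_shift: "D_tilde_op \<beta> = weighted_shift 1 \<beta>"
proof -
  have "diag_op \<beta> O graph shift = weighted_shift 1 \<beta>"
  proof (intro equalityI subrelI)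
    fix x z assume "(x, z) \<in> diag_op \<beta> O graph shift"
    then show "(x, z) \<in> weighted_shift 1 \<beta>"
      by (auto simp: graph_def diag_op_def weighted_shift_def shift.rep_eq split: nat.split)
  next
    fix x z assume xz: "(x, z) \<in> weighted_shift 1 \<beta>"
    \<comment> \<open>The intermediate vector \<open>\<beta>(\<K>)x\<close> is the backward shift of \<open>z\<close>, and so it is square-summable.\<close>
    define y where "y = Abs_ell2 (\<lambda>k. coord z (Suc k))"
    have y: "coord y k = coord z (Suc k)" for k
      using summable_Suc_iff[THEN iffD2, OF summable_coord[of z]] by (simp add: y_def coord_Abs)
    have z: "coord z j = (if j < 1 then 0 else \<beta> (j - 1) * coord x (j - 1))" for j
      using xz by (simp add: weighted_shift_iff)
    have "(x, y) \<in> diag_op \<beta>"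
      by (simp add: diag_op_def y z)
    moreover have "z = shift y"
    proof (rule ell2_eqI)
      show "coord z k = coord (shift y) k" for k
        by (cases k) (simp_all add: shift.rep_eq y z)
    qed
    ultimately show "(x, z) \<in> diag_op \<beta> O graph shift" by (auto simp: graph_def)
  qed
  then show ?thesis by (simp add: D_tilde_op_def closure_restrict_weighted_shift)
qed

lemma filterlim_add_pred_seq_iff:
  "filterlim (\<lambda>k. c + pred_seq \<beta> k) at_infinity sequentially \<longleftrightarrow> filterlim \<beta> at_infinity sequentially"
proof -
  have "filterlim (\<lambda>k. c + pred_seq \<beta> k) at_infinity sequentially
      \<longleftrightarrow> filterlim (\<lambda>k. c + \<beta> k) at_infinity sequentially"
    using filterlim_sequentially_Suc[of "\<lambda>k. c + pred_seq \<beta> k" at_infinity]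
    by (simp add: pred_seq_def)
  also have "\<dots> \<longleftrightarrow> filterlim \<beta> at_infinity sequentially"
    using tendsto_add_filterlim_at_infinity[OF tendsto_const[of c], of \<beta>]
      tendsto_add_filterlim_at_infinity[OF tendsto_const[of "- c"], of "\<lambda>k. c + \<beta> k"]
    by auto
  finally show ?thesis .
qed

theorem proposition7p1:
  fixes \<beta> :: "nat \<Rightarrow> complex" and c :: complex
  assumes "\<beta> \<in> c_inc"
  shows "(compact_parametrices (D_op \<beta> c) \<longleftrightarrow> filterlim \<beta> at_infinity sequentially) \<and>
         (compact_parametrices (D_tilde_op \<beta>) \<longleftrightarrow> filterlim \<beta> at_infinity sequentially)"
  by (simp add: D_op_eq_weighted_shift D_tilde_op_eq_weighted_shift
      compact_parametrices_weighted_shift_iff filterlim_add_pred_seq_iff)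

end
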